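(* Let $F$ be a finite forest with no isolated vertices and with at most one vertex of degree $2$, and let $n_1$ be the number of vertices of degree $1$ in $F$. Then \[ tvs(F)=\left\lceil \tfrac{n_1+1}{2} \right\rceil. \]
   Context: Graphs are finite, simple and undirected. For a graph $G$, a total weighting is a map $w: V(G)\cup E(G)\to \{1,2,\dots\}$; the weighted degree of a vertex $v$ is $wt_G(v)=w(v)+\sum_{e\in E(G),\, v\in e} w(e)$. The weighting is irregular if $wt_G(u)\neq wt_G(v)$ for all distinct $u,v\in V(G)$. The total vertex irregularity strength $tvs(G)$ is the smallest integer $s$ such that there is an irregular total weighting of $G$ with values in $\{1,2,\dots,s\}$. *)

theory Defs
  imports Complex_Main
begin

definition simple_graph :: "'a set \<Rightarrow> 'a set set \<Rightarrow> bool" where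
  "simple_graph V E \<longleftrightarrow> finite V \<and> (\<forall>e\<in>E. e \<subseteq> V \<and> card e = 2)"

definition degree :: "'a set set \<Rightarrow> 'a \<Rightarrow> nat" where
  "degree E v = card {e\<in>E. v \<in> e}"

definition is_cycle :: "'a set set \<Rightarrow> 'a list \<Rightarrow> bool" where
  "is_cycle E cs \<longleftrightarrow> length cs \<ge> 3 \<and> distinct cs \<and>
     (\<forall>i < length cs - 1. {cs ! i, cs ! (i+1)} \<in> E) \<and> {last cs, hd cs} \<in> E"

definition forest :: "'a set \<Rightarrow> 'a set set \<Rightarrow> bool" where
  "forest V E \<longleftrightarrow> simple_graph V E \<and> \<not> (\<exists>cs. set cs \<subseteq> V \<and> is_cycle E cs)"

definition wt :: "'a set set \<Rightarrow> ('a \<Rightarrow> nat) \<Rightarrow> ('a set \<Rightarrow> nat) \<Rightarrow> 'a \<Rightarrow> nat" where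
  "wt E wv we v = wv v + (\<Sum>e\<in>{e\<in>E. v \<in> e}. we e)"

definition irregular_total_weighting ::
  "'a set \<Rightarrow> 'a set set \<Rightarrow> nat \<Rightarrow> ('a \<Rightarrow> nat) \<Rightarrow> ('a set \<Rightarrow> nat) \<Rightarrow> bool" where
  "irregular_total_weighting V E s wv we \<longleftrightarrow>
     (\<forall>v\<in>V. wv v \<in> {1..s}) \<and> (\<forall>e\<in>E. we e \<in> {1..s}) \<and>
     inj_on (wt E wv we) V"

definition tvs :: "'a set \<Rightarrow> 'a set set \<Rightarrow> nat" where
  "tvs V E = (LEAST s. \<exists>wv we. irregular_total_weighting V E s wv we)"

end

theory Submission
  imports Defs
begin

text \<open>
  A leaf has weight in \<open>{2..2s}\<close>, which gives the lower bound. For the construction let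
  \<open>s = n\<^sub>1 div 2 + 1\<close>. Every edge between two inner vertices gets weight \<open>s\<close>, and the leaves,
  numbered from \<open>1\<close> to \<open>n\<^sub>1\<close>, get the weights \<open>2, \<dots>, n\<^sub>1 + 1\<close>; leaf number \<open>i\<close> still has
  the freedom to put any amount between \<open>max 1 (i + 1 - s)\<close> and \<open>min s i\<close> on its pendant edge.
  The inner vertices are also put in an order, and the one at position \<open>i\<close> should get a weight of about
  \<open>2s + i\<close>. If it has a leaf, one of its leaves receives the number \<open>i\<close>, so that its weighted
  degree grows along with \<open>i\<close>. Counting edges in the forest bounds the number of inner vertices and shows
  that only the last \<open>s\<close> of them can have edges too heavy for their target; for those a
  greedy choice of the vertex weight suffices.
\<close>

section \<open>Degree sums in forests\<close>

definition neighbours :: "'a set set \<Rightarrow> 'a \<Rightarrow> 'a set" where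
  "neighbours E v = {w. {v, w} \<in> E}"

lemma neighbours_sym: "w \<in> neighbours E v \<longleftrightarrow> v \<in> neighbours E w"
  by (simp add: neighbours_def insert_commute)

lemma edge_endpoints:
  assumes "simple_graph V E" "e \<in> E" "v \<in> e"
  obtains w where "e = {v, w}" "w \<noteq> v" "w \<in> V" "v \<in> V"
proof -
  have "card e = 2" "e \<subseteq> V" using assms by (auto simp: simple_graph_def)
  then obtain x y where "e = {x, y}" "x \<noteq> y" by (auto simp: card_2_iff)
  with assms(3) \<open>e \<subseteq> V\<close> that[of x] that[of y] show thesis by (auto simp: insert_commute)
qed

lemma neighbours_irrefl: "simple_graph V E \<Longrightarrow> v \<notin> neighbours E v"
  by (auto simp: neighbours_def simple_graph_def)

lemma neighbours_subset: "simple_graph V E \<Longrightarrow> neighbours E v \<subseteq> V"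
  by (auto simp: neighbours_def simple_graph_def)

lemma finite_neighbours: "simple_graph V E \<Longrightarrow> finite (neighbours E v)"
  by (meson finite_subset neighbours_subset simple_graph_def)

lemma sum_incident_edges:
  assumes "simple_graph V E"
  shows "(\<Sum>e\<in>{e\<in>E. v \<in> e}. g e) = (\<Sum>w\<in>neighbours E v. g {v, w})"
proof -
  have "bij_betw (\<lambda>w. {v, w}) (neighbours E v) {e\<in>E. v \<in> e}"
    unfolding bij_betw_def
  proof
    show "inj_on (\<lambda>w. {v, w}) (neighbours E v)"
      by (auto simp: inj_on_def doubleton_eq_iff)
    show "(\<lambda>w. {v, w}) ` neighbours E v = {e\<in>E. v \<in> e}"
      by (auto simp: neighbours_def elim: edge_endpoints[OF assms])
  qed
  then show ?thesis by (rule sum.reindex_bij_betw[symmetric])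
qed

lemma degree_eq_card_neighbours:
  "simple_graph V E \<Longrightarrow> degree E v = card (neighbours E v)"
  using sum_incident_edges[of V E "\<lambda>_. 1::nat" v] by (simp add: degree_def)

text \<open>Take a longest path inside \<open>W\<close>. If its first vertex had two neighbours in
  \<open>W\<close>, one of them would differ from the second vertex; by maximality it lies on the
  path, and the edge to it closes a cycle.\<close>

lemma ex_low_degree_vertex:
  assumes "forest V E" "W \<subseteq> V" "W \<noteq> {}"
  shows "\<exists>v\<in>W. card (neighbours E v \<inter> W) \<le> 1"
proof (rule ccontr)
  assume "\<not> ?thesis"
  then have two: "card (neighbours E v \<inter> W) \<ge> 2" if "v \<in> W" for v using that by force
  have sg: "simple_graph V E" using assms by (simp add: forest_def)
  have finW: "finite W" using sg assms finite_subset by (auto simp: simple_graph_def)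
  define path where "path xs \<longleftrightarrow> xs \<noteq> [] \<and> distinct xs \<and> set xs \<subseteq> W \<and>
    (\<forall>i < length xs - 1. {xs ! i, xs ! (i+1)} \<in> E)" for xs
  obtain w where "w \<in> W" using assms by auto
  then have "path [w]" by (simp add: path_def)
  moreover have "length xs < Suc (card W)" if "path xs" for xs
    using that finW by (metis card_mono distinct_card le_imp_less_Suc path_def)
  ultimately obtain xs where xs: "path xs" and max: "\<And>ys. path ys \<Longrightarrow> length ys \<le> length xs"
    using ex_has_greatest_nat[of path "[w]" length "Suc (card W)"] by (auto simp: less_imp_le)
  define x where "x = hd xs"
  have "x \<in> W" using xs by (auto simp: path_def x_def)
  have x0: "x = xs ! 0" using xs by (simp add: path_def x_def hd_conv_nth)
  have "\<not> neighbours E x \<inter> W \<subseteq> {xs ! 1}"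
    using two[OF \<open>x \<in> W\<close>] card_mono[of "{xs ! 1}" "neighbours E x \<inter> W"] by auto
  \<comment> \<open>On a one-vertex path \<open>xs ! 1\<close> is an unspecified value. This is
    harmless: then \<open>z\<close> could only be \<open>x\<close> itself, which is excluded
    separately.\<close>
  then obtain z where z: "{x, z} \<in> E" "z \<in> W" "z \<noteq> xs ! 1" by (auto simp: neighbours_def)
  have "z \<noteq> x" using z(1) neighbours_irrefl[OF sg, of x] by (auto simp: neighbours_def)
  have "z \<in> set xs"
  proof (rule ccontr)
    assume "z \<notin> set xs"
    have "{(z # xs) ! i, (z # xs) ! (i+1)} \<in> E" if "i < length xs" for i
    proof (cases i)
      case 0
      then show ?thesis using z x0 by (simp add: insert_commute)
    next
      case (Suc j)
      then show ?thesis using xs that by (simp add: path_def)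
    qed
    then have "path (z # xs)" using xs z \<open>z \<notin> set xs\<close> by (simp add: path_def)
    then show False using max[of "z # xs"] by simp
  qed
  then obtain j where j: "j < length xs" "z = xs ! j" by (auto simp: in_set_conv_nth)
  have "j \<noteq> 0" "j \<noteq> 1" using j z \<open>z \<noteq> x\<close> x0 by (auto intro: ccontr)
  then have "j \<ge> 2" by simp
  define cs where "cs = take (Suc j) xs"
  have len: "length cs = Suc j" using j by (simp add: cs_def)
  have "last cs = z" using j by (simp add: cs_def take_Suc_conv_app_nth)
  moreover have "hd cs = x" using xs by (simp add: cs_def x_def path_def)
  moreover have "{cs ! i, cs ! (i+1)} \<in> E" if "i < j" for i
    using xs that j by (auto simp: cs_def path_def)
  ultimately have "is_cycle E cs"
    using xs z len \<open>j \<ge> 2\<close> by (auto simp: is_cycle_def insert_commute path_def cs_def)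
  moreover have "set cs \<subseteq> V"
    using xs assms(2) set_take_subset[of "Suc j" xs] by (auto simp: cs_def path_def)
  ultimately show False using assms(1) by (auto simp: forest_def)
qed

text \<open>This is twice the bound of at most \<open>card W - 1\<close> edges in the subgraph
  induced on \<open>W\<close>. Deleting a vertex with at most one neighbour in \<open>W\<close>
  lowers the degree sum by at most 2 and the right-hand side by exactly 2.\<close>

lemma forest_induced_degree_sum:
  assumes "forest V E" "W \<subseteq> V" "W \<noteq> {}"
  shows "(\<Sum>v\<in>W. card (neighbours E v \<inter> W)) + 2 \<le> 2 * card W"
  using assms(2,3)
proof (induction "card W" arbitrary: W rule: less_induct)
  case less
  have sg: "simple_graph V E" using assms by (simp add: forest_def)
  have finW: "finite W" using sg less finite_subset by (auto simp: simple_graph_def)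
  obtain v where v: "v \<in> W" "card (neighbours E v \<inter> W) \<le> 1"
    using ex_low_degree_vertex[OF assms(1) less(2,3)] by auto
  define X where "X = W - {v}"
  have W: "W = insert v X" "v \<notin> X" "finite X" using v finW by (auto simp: X_def)
  have nv: "neighbours E v \<inter> W = neighbours E v \<inter> X"
    using neighbours_irrefl[OF sg] by (auto simp: W)
  show ?case
  proof (cases "X = {}")
    case True
    then show ?thesis using neighbours_irrefl[OF sg, of v] W by simp
  next
    case False
    have IH: "(\<Sum>w\<in>X. card (neighbours E w \<inter> X)) + 2 \<le> 2 * card X"
      using less(1)[of X] less(2) W False by auto
    have "card (neighbours E w \<inter> W) = card (neighbours E w \<inter> X) + (if v \<in> neighbours E w then 1 else 0)"
      if "w \<in> X" for w
    proof -
      have "neighbours E w \<inter> W = (if v \<in> neighbours E w then insert v (neighbours E w \<inter> X) else neighbours E w \<inter> X)"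
        by (auto simp: W)
      then show ?thesis using W by auto
    qed
    then have "(\<Sum>w\<in>X. card (neighbours E w \<inter> W)) = (\<Sum>w\<in>X. card (neighbours E w \<inter> X)) + card {w\<in>X. v \<in> neighbours E w}"
      using W(3) by (simp add: sum.distrib sum.If_cases Int_def)
    moreover have "{w\<in>X. v \<in> neighbours E w} = neighbours E v \<inter> X" using neighbours_sym by fast
    ultimately have "(\<Sum>w\<in>W. card (neighbours E w \<inter> W)) = (\<Sum>w\<in>X. card (neighbours E w \<inter> X)) + 2 * card (neighbours E v \<inter> X)"
      using W nv by simp
    then show ?thesis using IH v(2) nv W by simp
  qed
qed

section \<open>Numberings and greedy choices\<close>

lemma bij_betw_append:
  fixes h h' :: "'a \<Rightarrow> nat"
  assumes "bij_betw h A {1..n}" "bij_betw h' B {1..m}" "A \<inter> B = {}"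
  shows "\<exists>q. bij_betw q (A \<union> B) {1..n + m} \<and> (\<forall>x\<in>A. q x = h x) \<and> (\<forall>x\<in>B. q x = n + h' x)"
proof -
  define q where "q x = (if x \<in> A then h x else n + h' x)" for x
  have A: "bij_betw q A {1..n}"
    using assms(1) by (rule bij_betw_cong[THEN iffD1, rotated]) (simp add: q_def)
  have qB: "q x = n + h' x" if "x \<in> B" for x using assms(3) that by (auto simp: q_def)
  have "bij_betw ((+) n) {1..m} {n + 1..n + m}"
    by (simp add: bij_betw_def)
  from bij_betw_trans[OF assms(2) this] have "bij_betw q B {n + 1..n + m}"
    by (rule bij_betw_cong[THEN iffD1, rotated]) (simp add: qB)
  then have "bij_betw q (A \<union> B) ({1..n} \<union> {n + 1..n + m})"
    by (intro bij_betw_combine A) auto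
  moreover have "{1..n} \<union> {n + 1..n + m} = {1..n + m}" by auto
  ultimately have "bij_betw q (A \<union> B) {1..n + m}" by simp
  moreover have "\<forall>x\<in>A. q x = h x" by (simp add: q_def)
  ultimately show ?thesis using qB by blast
qed

text \<open>Used to carry a numbering of vertices over to the leaves selected for them.\<close>

lemma bij_betw_push:
  assumes "inj_on p D" "bij_betw e D X"
  shows "\<exists>h. bij_betw h (p ` D) X \<and> (\<forall>v\<in>D. h (p v) = e v)"
proof -
  define h where "h = e \<circ> the_inv_into D p"
  have "bij_betw h (p ` D) X" unfolding h_def
    by (rule bij_betw_trans[OF _ assms(2)]) (simp add: assms(1) bij_betw_the_inv_into inj_on_imp_bij_betw)
  moreover have "\<forall>v\<in>D. h (p v) = e v" using assms(1) by (simp add: h_def the_inv_into_f_f)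
  ultimately show ?thesis by blast
qed

lemma finite_enumeration:
  fixes A :: "'a set"
  assumes "finite A"
  obtains e :: "'a \<Rightarrow> nat" where "bij_betw e A {1..card A}"
  using ex_bij_betw_finite_nat[OF assms] bij_betw_iff_card[of A "{1..card A}"] assms by auto

text \<open>The elements are served one at a time. Each has \<open>s\<close> candidates, while
  \<open>C\<close> and the values already taken block fewer than \<open>s\<close> of them.\<close>

lemma greedy_choice:
  fixes S :: "'a \<Rightarrow> nat"
  assumes "finite R" "finite C" "card C + card R \<le> s"
  shows "\<exists>W. inj_on W R \<and> (\<forall>v\<in>R. S v < W v \<and> W v \<le> S v + s \<and> W v \<notin> C)"
  using assms
proof (induction R)
  case empty
  then show ?case by simp
next
  case (insert v R)
  then obtain W where W: "inj_on W R" "\<forall>v\<in>R. S v < W v \<and> W v \<le> S v + s \<and> W v \<notin> C" by auto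
  have "card (C \<union> W ` R) \<le> card C + card R"
    using card_Un_le[of C "W ` R"] card_image_le[of R W] insert by linarith
  then have "card (C \<union> W ` R) < card {S v <.. S v + s}" using insert by simp
  then have "\<not> {S v <.. S v + s} \<subseteq> C \<union> W ` R"
    using insert card_mono[of "C \<union> W ` R" "{S v <.. S v + s}"] by auto
  then obtain t where t: "S v < t" "t \<le> S v + s" "t \<notin> C" "t \<notin> W ` R"
    by (metis UnI1 UnI2 greaterThanAtMost_iff subsetI)
  have "inj_on (W(v := t)) (insert v R)" using W t insert by (auto simp: inj_on_def)
  moreover have "\<forall>u\<in>insert v R. S u < (W(v := t)) u \<and> (W(v := t)) u \<le> S u + s \<and> (W(v := t)) u \<notin> C"
    using W t by auto
  ultimately show ?case by blast
qed

text \<open>The vertices with \<^term>\<open>S v < B + pos v\<close> receive exactly \<^term>\<open>B + pos v\<close>. There are at most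
  \<^term>\<open>s\<close> vertices at the top positions, so each of the others has a free value among its
  \<^term>\<open>s\<close> candidates.\<close>

lemma distinct_targets:
  fixes S pos :: "'a \<Rightarrow> nat"
  assumes fin: "finite I" and inj: "inj_on pos I" and le: "\<And>v. v \<in> I \<Longrightarrow> pos v \<le> N"
    and reach: "\<And>v. v \<in> I \<Longrightarrow> B + pos v \<le> S v + s"
    and low: "\<And>v. v \<in> I \<Longrightarrow> pos v \<le> N - s \<Longrightarrow> S v < B + pos v"
  shows "\<exists>W. inj_on W I \<and> (\<forall>v\<in>I. B \<le> W v \<and> S v < W v \<and> W v \<le> S v + s)"
proof -
  define X where "X = {v\<in>I. S v < B + pos v}"
  define R where "R = I - X"
  define Top where "Top = {v\<in>X. N - s < pos v}"
  define C where "C = (\<lambda>v. B + pos v) ` Top"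
  have R: "N - s < pos v \<and> B + pos v \<le> S v" if "v \<in> R" for v
    using that low[of v] by (force simp: R_def X_def)
  have finR: "finite R" "finite Top" using fin by (auto simp: R_def Top_def X_def)
  \<comment> \<open>\<open>Top\<close> and \<open>R\<close> together occupy distinct positions among
    the last \<open>s\<close>, so the values reserved in \<open>C\<close> and the elements of
    \<open>R\<close> meet the bound required by the greedy choice.\<close>
  have "pos ` (Top \<union> R) \<subseteq> {N - s <.. N}" 
  proof
    fix t assume "t \<in> pos ` (Top \<union> R)"
    then obtain v where "t = pos v" "v \<in> Top \<union> R" by auto
    then show "t \<in> {N - s <.. N}" using R[of v] le[of v] by (auto simp: Top_def R_def X_def)
  qed
  then have "card (pos ` (Top \<union> R)) \<le> N - (N - s)"
    using card_mono[of "{N - s <.. N}"] by fastforce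
  moreover have "inj_on pos (Top \<union> R)"
    by (rule inj_on_subset[OF inj]) (auto simp: Top_def R_def X_def)
  moreover have "card (Top \<union> R) = card Top + card R"
    using finR by (intro card_Un_disjoint) (auto simp: Top_def R_def)
  moreover have "card C \<le> card Top" using finR by (simp add: C_def card_image_le)
  ultimately have "card C + card R \<le> s" by (simp add: card_image)
  then obtain W where W: "inj_on W R" "\<forall>v\<in>R. S v < W v \<and> W v \<le> S v + s \<and> W v \<notin> C"
    using greedy_choice[of R C s S] finR by (auto simp: C_def)
  define Q where "Q v = (if v \<in> X then B + pos v else W v)" for v
  \<comment> \<open>Values of \<open>Top\<close> lie in \<open>C\<close> and are avoided by the
    greedy choice. Any other \<open>v\<close> in \<open>X\<close> has a smaller position than
    \<open>w\<close>, so \<open>Q v = B + pos v < B + pos w <= S w < W w\<close>.\<close>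
  have QX: "Q v \<noteq> W w" if "v \<in> X" "w \<in> R" for v w
  proof (cases "v \<in> Top")
    case True
    then have "Q v \<in> C" using that by (auto simp: C_def Q_def)
    then show ?thesis using W that by metis
  next
    case False
    then have "pos v < pos w" using that R[of w] by (auto simp: Top_def)
    then show ?thesis using W that R[of w] by (fastforce simp: Q_def)
  qed
  have "inj_on Q I"
  proof (rule inj_onI)
    fix v w assume "v \<in> I" "w \<in> I" "Q v = Q w"
    then show "v = w"
      using QX[of v w] QX[of w v] inj_onD[OF inj, of v w] inj_onD[OF W(1), of v w]
      by (auto simp: Q_def R_def split: if_splits)
  qed
  moreover have "B \<le> Q v \<and> S v < Q v \<and> Q v \<le> S v + s" if "v \<in> I" for v
  proof (cases "v \<in> X")
    case True
    then show ?thesis using reach[OF that] by (simp add: Q_def X_def)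
  next
    case False
    then have "v \<in> R" using that by (simp add: R_def)
    then have "S v < W v" "W v \<le> S v + s" "B + pos v \<le> S v" using W R[of v] by auto
    then show ?thesis using False by (simp add: Q_def)
  qed
  ultimately show ?thesis by blast
qed

section \<open>Leaves and inner vertices\<close>

text \<open>\<^term>\<open>I\<close> is the set of inner vertices, \<^term>\<open>U\<close> contains those of degree 2, \<^term>\<open>K v\<close> is the set of
  leaves at \<^term>\<open>v\<close>, and \<^term>\<open>d v\<close> is the number of its inner neighbours. The components that are
  single edges are indexed by \<^term>\<open>P\<close>, with end points \<^term>\<open>a p\<close> and \<^term>\<open>b p\<close>.\<close>

locale pendant_structure =
  fixes I U L :: "'a set" and K :: "'a \<Rightarrow> 'a set" and d :: "'a \<Rightarrow> nat"
    and P :: "'b set" and a b :: "'b \<Rightarrow> 'a"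
  assumes finI: "finite I" and finL: "finite L" and finP: "finite P"
    and UI: "U \<subseteq> I" and cardU: "card U \<le> 1"
    and degU: "v \<in> U \<Longrightarrow> card (K v) + d v = 2"
    and degJ: "v \<in> I - U \<Longrightarrow> 3 \<le> card (K v) + d v"
    and K_disj: "v \<in> I \<Longrightarrow> w \<in> I \<Longrightarrow> v \<noteq> w \<Longrightarrow> K v \<inter> K w = {}"
    and inj_a: "inj_on a P" and inj_b: "inj_on b P" and ab_disj: "a ` P \<inter> b ` P = {}"
    and K_ab_disj: "\<Union>(K ` I) \<inter> (a ` P \<union> b ` P) = {}"
    and L_eq: "L = \<Union>(K ` I) \<union> a ` P \<union> b ` P"
    and excess: "(\<Sum>v\<in>I - U. card (K v) + d v - 2) + 2 \<le> card L"
    and branching: "card {v\<in>I. 3 \<le> d v} \<le> card {v\<in>I. d v = 1}"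
begin

text \<open>The vertices of degree at least 3 are positioned in the order \<open>G, Y1, Y2, Z\<close>.
  A vertex in \<open>G\<close> has only two edges besides that of its first leaf, so it is never too heavy. In
  \<open>Y1\<close> this is achieved by making one further pendant edge as light as possible. There are at most
  \<open>s\<close> vertices in \<open>Y2\<close> and \<open>Z\<close>, which may be too heavy.\<close>

definition "k v = card (K v)"
definition "n = card L"
definition "s = n div 2 + 1"
text \<open>Targets start at \<open>2 * s + offset\<close>. The value 2 leaves room for
  \<open>Y1\<close>, where the edge weights may add up to \<open>2 * s + pos v + 1\<close>. For
  \<open>s = 2\<close> only 1 is possible: with \<open>n = 2\<close>, the two leaf edges at a vertex
  of degree 2 carry at most \<open>1 + 2 = s + 1\<close>.\<close>

definition "offset = min 2 (s - 1)"
definition "J = I - U"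
definition "G = {v\<in>J. 1 \<le> k v \<and> d v + k v = 3}"
definition "Y1 = {v\<in>J. d v = 1 \<and> k v = 3}"
definition "Y2 = {v\<in>J. 1 \<le> k v \<and> 4 \<le> d v + k v} - Y1"
definition "Z = {v\<in>J. k v = 0}"
definition "D = G \<union> Y1 \<union> Y2"

section \<open>Sizes of the classes of inner vertices\<close>

lemma finite_classes [simp]: "finite J" "finite U" "finite G" "finite Y1" "finite Y2" "finite Z" "finite D"
  using finI UI finite_subset by (auto simp: J_def G_def Y1_def Y2_def Z_def D_def)

lemma finite_K: "v \<in> I \<Longrightarrow> finite (K v)"
  by (rule finite_subset[OF _ finL]) (auto simp: L_eq)

lemma deg_J: "v \<in> J \<Longrightarrow> 3 \<le> k v + d v"
  using degJ by (simp add: J_def k_def)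

lemma deg_U: "v \<in> U \<Longrightarrow> k v + d v = 2"
  using degU by (simp add: k_def)

lemma classes_disjoint:
  "G \<inter> Y1 = {}" "(G \<union> Y1) \<inter> Y2 = {}" "D \<inter> Z = {}"
  by (auto simp: G_def Y1_def Y2_def Z_def D_def)

lemma J_eq: "J = D \<union> Z"
  using deg_J by (fastforce simp: G_def Y1_def Y2_def Z_def D_def)

lemma D_eq: "D = {v\<in>J. 1 \<le> k v}"
  unfolding J_eq by (auto simp: G_def Y1_def Y2_def Z_def D_def)

lemma card_D: "card D = card G + card Y1 + card Y2"
  by (simp add: D_def card_Un_disjoint classes_disjoint)

lemma card_J: "card J = card G + card Y1 + card Y2 + card Z"
  by (simp add: J_eq card_Un_disjoint classes_disjoint card_D)

lemma n_eq: "n = (\<Sum>v\<in>I. k v) + 2 * card P"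
proof -
  have "card (\<Union>(K ` I)) = (\<Sum>v\<in>I. k v)"
    unfolding k_def using K_disj finite_K finI by (intro card_UN_disjoint) auto
  moreover have "card (a ` P \<union> b ` P) = 2 * card P"
    using finP ab_disj inj_a inj_b by (simp add: card_Un_disjoint card_image)
  moreover have "card L = card (\<Union>(K ` I)) + card (a ` P \<union> b ` P)"
    unfolding L_eq Un_assoc using K_ab_disj finite_K finI finP by (intro card_Un_disjoint) auto
  ultimately show ?thesis by (simp add: n_def)
qed

lemma sum_indicator:
  "finite A \<Longrightarrow> (\<Sum>v\<in>A. if p v then c else 0) = c * card {v\<in>A. p v}" for c :: nat
  by (simp add: sum.If_cases Int_def)

text \<open>Each vertex of \<open>J\<close> contributes its degree minus 2 to \<open>excess\<close>:
  this is 1 on \<open>G\<close>, 2 on \<open>Y1\<close>, at least 2 on \<open>Y2\<close> and at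
  least 1 on \<open>Z\<close>.\<close>

lemma count_excess: "card G + 2 * card Y1 + 2 * card Y2 + card Z + 2 \<le> n"
proof -
  have "1 * card {v\<in>J. v \<in> G} + 2 * card {v\<in>J. v \<in> Y1} + 2 * card {v\<in>J. v \<in> Y2} + 1 * card {v\<in>J. v \<in> Z}
     = (\<Sum>v\<in>J. (if v \<in> G then 1 else 0) + (if v \<in> Y1 then 2 else 0) + (if v \<in> Y2 then 2 else 0) + (if v \<in> Z then 1 else 0))"
    by (simp add: sum.distrib sum_indicator)
  also have "\<dots> \<le> (\<Sum>v\<in>J. k v + d v - 2)"
  proof (rule sum_mono)
    fix v assume "v \<in> J"
    then show "(if v \<in> G then 1 else 0) + (if v \<in> Y1 then 2 else 0) + (if v \<in> Y2 then 2 else 0) + (if v \<in> Z then 1 else 0) \<le> k v + d v - 2"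
      using deg_J[of v] by (auto simp: G_def Y1_def Y2_def Z_def)
  qed
  also have "\<dots> + 2 \<le> n" using excess by (simp add: n_def k_def J_def)
  finally have "card {v\<in>J. v \<in> G} + 2 * card {v\<in>J. v \<in> Y1} + 2 * card {v\<in>J. v \<in> Y2} + card {v\<in>J. v \<in> Z} + 2 \<le> n"
    by simp
  moreover have "{v\<in>J. v \<in> G} = G" "{v\<in>J. v \<in> Y1} = Y1" "{v\<in>J. v \<in> Y2} = Y2" "{v\<in>J. v \<in> Z} = Z"
    by (auto simp: G_def Y1_def Y2_def Z_def)
  ultimately show ?thesis by simp
qed

lemma n_ge_2: "2 \<le> n"
  using count_excess by simp

lemma s_ge_2: "2 \<le> s"
  using n_ge_2 by (simp add: s_def)

lemma n_less: "n < 2 * s"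
  by (simp add: s_def)

text \<open>A vertexwise inequality is summed over \<open>I\<close>, and \<open>branching\<close>
  cancels the terms for \<open>d v = 1\<close> against those for \<open>3 <= d v\<close>. The
  inequality would fail for \<open>d v = 1\<close>, \<open>k v = 3\<close>, which is why
  \<open>Y1\<close> is split off from \<open>Y2\<close>.\<close>

lemma count_high: "card Z + card Y2 \<le> s"
proof -
  have "2 * card {v\<in>I. v \<in> Z \<or> v \<in> Y2} + 2 * card {v\<in>I. d v = 1}
     = (\<Sum>v\<in>I. (if v \<in> Z \<or> v \<in> Y2 then 2 else 0) + (if d v = 1 then 2 else 0))"
    using finI by (simp add: sum.distrib sum_indicator)
  also have "\<dots> \<le> (\<Sum>v\<in>I. k v + (if v \<in> U then 1 else 0) + (if 3 \<le> d v then 2 else 0))"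
  proof (rule sum_mono)
    fix v assume "v \<in> I"
    then consider "v \<in> U" "v \<notin> J" | "v \<notin> U" "v \<in> J" by (auto simp: J_def)
    then show "(if v \<in> Z \<or> v \<in> Y2 then 2 else 0) + (if d v = 1 then 2 else 0)
        \<le> k v + (if v \<in> U then 1 else 0) + (if 3 \<le> d v then 2 else 0)"
    proof cases
      case 1
      then show ?thesis using deg_U[of v] by (auto simp: Y2_def Z_def)
    next
      case 2
      then show ?thesis using deg_J[of v] by (auto simp: Y1_def Y2_def Z_def)
    qed
  qed
  also have "\<dots> = (\<Sum>v\<in>I. k v) + card {v\<in>I. v \<in> U} + 2 * card {v\<in>I. 3 \<le> d v}"
    using finI by (simp add: sum.distrib sum_indicator)
  also have "{v\<in>I. v \<in> U} = U" using UI by auto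
  also have "{v\<in>I. v \<in> Z \<or> v \<in> Y2} = Z \<union> Y2" by (auto simp: J_def Z_def Y2_def)
  also have "card (Z \<union> Y2) = card Z + card Y2"
    by (intro card_Un_disjoint) (auto simp: Z_def Y2_def)
  finally have "2 * (card Z + card Y2) \<le> n + 1" using branching cardU by (simp add: n_eq)
  then show ?thesis by (simp add: s_def)
qed

section \<open>Numbering the inner vertices and the leaves\<close>

lemma K_unique: "v \<in> I \<Longrightarrow> w \<in> I \<Longrightarrow> x \<in> K v \<Longrightarrow> x \<in> K w \<Longrightarrow> v = w"
  using K_disj by blast

lemma class_subsets: "D \<subseteq> I" "Y1 \<subseteq> D" "G \<subseteq> D" "Y2 \<subseteq> D" "J \<subseteq> I" "Z \<subseteq> J"
  by (auto simp: D_def G_def Y1_def Y2_def J_def Z_def)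

lemma card_J_D: "card J = card D + card Z"
  by (simp add: card_J card_D)

text \<open>The leaf \<open>pr v\<close> will be numbered like \<^term>\<open>v\<close>, the leaf \<open>te v\<close> will get a light pendant edge,
  and the leaves in \<open>T v\<close> will come last, with heavy pendant edges: they belong to vertices
  which do not have enough inner edges to reach their target otherwise.\<close>

lemma special_leaves:
  obtains pr te T where
    "\<And>v. v \<in> D \<Longrightarrow> pr v \<in> K v"
    "\<And>v. v \<in> Y1 \<Longrightarrow> te v \<in> K v \<and> te v \<noteq> pr v"
    "\<And>v. v \<in> I \<Longrightarrow> T v \<subseteq> K v"
    "\<And>v. v \<in> U \<Longrightarrow> T v = K v"
    "\<And>v. v \<in> J \<Longrightarrow> d v = 0 \<Longrightarrow> card (T v) = 2"
    "\<And>v. v \<in> J \<Longrightarrow> pr v \<notin> T v"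
    "\<And>v. v \<in> J \<Longrightarrow> d v \<noteq> 0 \<Longrightarrow> T v = {}"
proof -
  have "\<exists>x. x \<in> K v" if "v \<in> D" for v
  proof -
    have "K v \<noteq> {}" using that by (auto simp: D_eq k_def)
    then show ?thesis by auto
  qed
  then obtain pr where pr: "\<And>v. v \<in> D \<Longrightarrow> pr v \<in> K v" by metis
  have card_other: "card (K v - {pr v}) = k v - 1" if "v \<in> D" for v
    using pr[OF that] that class_subsets finite_K by (auto simp: k_def card_Diff_singleton)
  have "\<exists>x. x \<in> K v \<and> x \<noteq> pr v" if "v \<in> Y1" for v
  proof -
    have "card (K v - {pr v}) = 2" using card_other[of v] that class_subsets by (auto simp: Y1_def)
    then have "K v - {pr v} \<noteq> {}" by force
    then show ?thesis by auto
  qed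
  then obtain te where te: "\<And>v. v \<in> Y1 \<Longrightarrow> te v \<in> K v \<and> te v \<noteq> pr v" by metis
  have "\<exists>X. X \<subseteq> K v - {pr v} \<and> card X = 2" if "v \<in> J" "d v = 0" for v
  proof -
    have "3 \<le> k v" using deg_J[OF that(1)] that(2) by simp
    then have "2 \<le> card (K v - {pr v})" using card_other[of v] that by (simp add: D_eq)
    then show ?thesis by (meson obtain_subset_with_card_n)
  qed
  then obtain X where X: "\<And>v. v \<in> J \<Longrightarrow> d v = 0 \<Longrightarrow> X v \<subseteq> K v - {pr v} \<and> card (X v) = 2" by metis
  define T where "T v = (if v \<in> U then K v else if d v = 0 then X v else {})" for v
  show thesis
  proof (rule that[of pr te T])
    show "T v \<subseteq> K v" if "v \<in> I" for v using that X[of v] by (auto simp: T_def J_def)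
    show "card (T v) = 2" if "v \<in> J" "d v = 0" for v using that X[of v] by (auto simp: T_def J_def)
    show "pr v \<notin> T v" if "v \<in> J" for v using that X[of v] by (auto simp: T_def J_def)
    show "T v = {}" if "v \<in> J" "d v \<noteq> 0" for v using that by (auto simp: T_def J_def)
  qed (use pr te in \<open>auto simp: T_def\<close>)
qed

text \<open>The leaves are numbered block by block: \<open>pr\<close> leaves, \<open>te\<close>
  leaves, the ends \<open>a\<close>, the ends \<open>b\<close>, the remaining ones, and
  \<open>T\<close> last. All the stated offsets are differences between the starting points of
  blocks.\<close>

lemma numbering:
  fixes pr te :: "'a \<Rightarrow> 'a" and T :: "'a set"
  assumes inj_pr: "inj_on pr D" and inj_te: "inj_on te Y1"
    and prD: "pr ` D \<subseteq> \<Union>(K ` I)" and teY: "te ` Y1 \<subseteq> \<Union>(K ` I)" and TK: "T \<subseteq> \<Union>(K ` I)"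
    and disj: "pr ` D \<inter> te ` Y1 = {}" "T \<inter> pr ` D = {}" "T \<inter> te ` Y1 = {}"
  obtains pos idx :: "'a \<Rightarrow> nat" where
    "bij_betw pos J {1..card J}"
    "\<And>v. v \<in> D \<Longrightarrow> pos v \<le> card D"
    "\<And>v. v \<in> Y2 \<union> Z \<Longrightarrow> card G + card Y1 < pos v"
    "bij_betw idx L {1..n}"
    "\<And>v. v \<in> D \<Longrightarrow> idx (pr v) = pos v"
    "\<And>x. x \<in> L \<Longrightarrow> x \<notin> pr ` D \<Longrightarrow> card D < idx x"
    "\<And>v. v \<in> Y1 \<Longrightarrow> idx (te v) = pos v + card Y1 + card Y2"
    "\<And>p. p \<in> P \<Longrightarrow> idx (b p) = idx (a p) + card P"
    "\<And>x. x \<in> T \<Longrightarrow> n < idx x + card T"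
proof -
  obtain eG where eG: "bij_betw eG G {1..card G}" by (rule finite_enumeration[of G]) simp
  obtain e1 where e1: "bij_betw e1 Y1 {1..card Y1}" by (rule finite_enumeration[of Y1]) simp
  obtain e2 where e2: "bij_betw e2 Y2 {1..card Y2}" by (rule finite_enumeration[of Y2]) simp
  obtain e3 where e3: "bij_betw e3 Z {1..card Z}" by (rule finite_enumeration[of Z]) simp
  obtain eP where eP: "bij_betw eP P {1..card P}" by (rule finite_enumeration[of P]) (simp add: finP)
  obtain q1 where q1: "bij_betw q1 (G \<union> Y1) {1..card G + card Y1}"
      "\<And>x. x \<in> G \<Longrightarrow> q1 x = eG x" "\<And>x. x \<in> Y1 \<Longrightarrow> q1 x = card G + e1 x"
    using bij_betw_append[OF eG e1 classes_disjoint(1)] by blast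
  obtain q2 where q2: "bij_betw q2 D {1..card D}"
      "\<And>x. x \<in> G \<union> Y1 \<Longrightarrow> q2 x = q1 x" "\<And>x. x \<in> Y2 \<Longrightarrow> q2 x = card G + card Y1 + e2 x"
    using bij_betw_append[OF q1(1) e2 classes_disjoint(2), folded card_D D_def] by blast
  obtain pos where pos: "bij_betw pos J {1..card J}"
      "\<And>x. x \<in> D \<Longrightarrow> pos x = q2 x" "\<And>x. x \<in> Z \<Longrightarrow> pos x = card D + e3 x"
    using bij_betw_append[OF q2(1) e3 classes_disjoint(3), folded J_eq card_J_D] by blast
  have range: "\<And>v. v \<in> Y2 \<Longrightarrow> 1 \<le> e2 v" "\<And>v. v \<in> Z \<Longrightarrow> 1 \<le> e3 v" "\<And>v. v \<in> D \<Longrightarrow> q2 v \<le> card D"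
    using e2 e3 q2(1) by (auto dest!: bij_betw_apply)
  have posY1: "pos v = card G + e1 v" if "v \<in> Y1" for v
    using that pos q1 q2 class_subsets by auto
  obtain hp where hp: "bij_betw hp (pr ` D) {1..card D}" "\<And>v. v \<in> D \<Longrightarrow> hp (pr v) = q2 v"
    using bij_betw_push[OF inj_pr q2(1)] by blast
  obtain ht where ht: "bij_betw ht (te ` Y1) {1..card Y1}" "\<And>v. v \<in> Y1 \<Longrightarrow> ht (te v) = e1 v"
    using bij_betw_push[OF inj_te e1] by blast
  obtain ha where ha: "bij_betw ha (a ` P) {1..card P}" "\<And>v. v \<in> P \<Longrightarrow> ha (a v) = eP v"
    using bij_betw_push[OF inj_a eP] by blast
  obtain hb where hb: "bij_betw hb (b ` P) {1..card P}" "\<And>v. v \<in> P \<Longrightarrow> hb (b v) = eP v"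
    using bij_betw_push[OF inj_b eP] by blast
  define A1 where "A1 = pr ` D \<union> te ` Y1"
  define A2 where "A2 = A1 \<union> a ` P"
  define A3 where "A3 = A2 \<union> b ` P"
  define R where "R = L - A3 - T"
  have dj: "A1 \<inter> a ` P = {}" "A2 \<inter> b ` P = {}" "A3 \<inter> R = {}" "(A3 \<union> R) \<inter> T = {}" "A3 \<union> R \<union> T = L"
  proof -
    \<comment> \<open>Here \<open>M\<close> stands for the leaves at inner vertices,
      \<open>p\<close> and \<open>t\<close> for the \<open>pr\<close> and \<open>te\<close> leaves
      in it, and \<open>q\<close> and \<open>r\<close> for the two ends of the single-edge
      components.\<close>
    have "(p \<union> t) \<inter> q = {} \<and> (p \<union> t \<union> q) \<inter> r = {} \<and> (p \<union> t \<union> q \<union> r \<union> (M \<union> q \<union> r - (p \<union> t \<union> q \<union> r) - T)) \<inter> T = {}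
        \<and> p \<union> t \<union> q \<union> r \<union> (M \<union> q \<union> r - (p \<union> t \<union> q \<union> r) - T) \<union> T = M \<union> q \<union> r"
      if "p \<subseteq> M" "t \<subseteq> M" "T \<subseteq> M" "T \<inter> p = {}" "T \<inter> t = {}" "M \<inter> (q \<union> r) = {}" "q \<inter> r = {}"
      for p t q r M :: "'a set"
      using that by auto
    from this[OF prD teY TK disj(2,3) K_ab_disj ab_disj]
    show "A1 \<inter> a ` P = {}" "A2 \<inter> b ` P = {}" "(A3 \<union> R) \<inter> T = {}" "A3 \<union> R \<union> T = L"
      unfolding A1_def A2_def A3_def R_def L_eq by simp_all
    show "A3 \<inter> R = {}" by (auto simp: R_def)
  qed
  have "finite L" by (rule finL)
  then have finRT: "finite R" "finite T" using dj(5) by (metis finite_Un)+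
  obtain eR where eR: "bij_betw eR R {1..card R}" by (rule finite_enumeration[OF finRT(1)])
  obtain eT where eT: "bij_betw eT T {1..card T}" by (rule finite_enumeration[OF finRT(2)])
  let ?c1 = "card D + card Y1"
  obtain h1 where h1: "bij_betw h1 A1 {1..?c1}"
      "\<forall>x\<in>pr ` D. h1 x = hp x" "\<forall>x\<in>te ` Y1. h1 x = card D + ht x"
    using bij_betw_append[OF hp(1) ht(1) disj(1), folded A1_def] by (elim exE conjE) (rule that)
  obtain h2 where h2: "bij_betw h2 A2 {1..?c1 + card P}"
      "\<forall>x\<in>A1. h2 x = h1 x" "\<forall>x\<in>a ` P. h2 x = ?c1 + ha x"
    using bij_betw_append[OF h1(1) ha(1) dj(1), folded A2_def] by (elim exE conjE) (rule that)
  obtain h3 where h3: "bij_betw h3 A3 {1..?c1 + card P + card P}"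
      "\<forall>x\<in>A2. h3 x = h2 x" "\<forall>x\<in>b ` P. h3 x = ?c1 + card P + hb x"
    using bij_betw_append[OF h2(1) hb(1) dj(2), folded A3_def] by (elim exE conjE) (rule that)
  obtain h4 where h4: "bij_betw h4 (A3 \<union> R) {1..?c1 + card P + card P + card R}"
      "\<forall>x\<in>A3. h4 x = h3 x" "\<forall>x\<in>R. h4 x = ?c1 + card P + card P + eR x"
    using bij_betw_append[OF h3(1) eR dj(3)] by (elim exE conjE) (rule that)
  obtain idx where idx: "bij_betw idx L {1..?c1 + card P + card P + card R + card T}"
      "\<forall>x\<in>A3 \<union> R. idx x = h4 x" "\<forall>x\<in>T. idx x = ?c1 + card P + card P + card R + eT x"
    using bij_betw_append[OF h4(1) eT dj(4), unfolded dj(5)] by (elim exE conjE) (rule that)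
  have n: "?c1 + card P + card P + card R + card T = n"
    using bij_betw_same_card[OF idx(1)] by (simp add: n_def)
  have idx_A3: "idx x = h3 x" if "x \<in> A3" for x
    using that idx(2) h4(2) by simp
  have idx_A2: "idx x = h2 x" if "x \<in> A2" for x
    using that idx_A3 h3(2) by (simp add: A3_def)
  have idx_A1: "idx x = h1 x" if "x \<in> A1" for x
    using that idx_A2 h2(2) by (simp add: A2_def)
  have idx_pr: "idx x = hp x" if "x \<in> pr ` D" for x
    using that bspec[OF h1(2) that] by (simp add: idx_A1 A1_def)
  show thesis
  proof (rule that[of pos idx])
    show "bij_betw pos J {1..card J}" by (rule pos)
    show "bij_betw idx L {1..n}" using idx(1) n by simp
    show "pos v \<le> card D" if "v \<in> D" for v using that pos(2) range(3) by simp
    show "card G + card Y1 < pos v" if "v \<in> Y2 \<union> Z" for v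
    proof (cases "v \<in> Y2")
      case True
      then have "v \<in> D" using class_subsets by auto
      then show ?thesis using pos(2) q2(3)[OF True] range(1)[OF True] by simp
    next
      case False
      then have "v \<in> Z" using that by simp
      then show ?thesis using pos(3)[of v] range(2)[of v] by (simp add: card_D)
    qed
    show pr: "idx (pr v) = pos v" if "v \<in> D" for v using that idx_pr hp(2) pos(2) by simp
    \<comment> \<open>The \<open>pr\<close> leaves already use up all numbers in
      \<open>{1..card D}\<close>, so injectivity forbids these to every other leaf.\<close>
    show "card D < idx x" if "x \<in> L" "x \<notin> pr ` D" for x
    proof (rule ccontr)
      assume "\<not> card D < idx x"
      moreover have "1 \<le> idx x" using bij_betw_apply[OF idx(1) that(1)] by simp
      ultimately have "idx x \<in> {1..card D}" by simp
      then obtain y where y: "y \<in> pr ` D" "idx x = hp y" using hp(1) by (metis bij_betw_iff_bijections)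
      then have "idx x = idx y" using idx_pr by simp
      moreover have "y \<in> L" using y prD by (auto simp: L_eq)
      ultimately have "x = y" using idx(1) that(1) by (metis bij_betw_imp_inj_on inj_onD)
      then show False using y that by simp
    qed
    show "idx (te v) = pos v + card Y1 + card Y2" if "v \<in> Y1" for v
      using that posY1 ht(2) h1(3) idx_A1[of "te v"] by (simp add: A1_def card_D)
    show "idx (b p) = idx (a p) + card P" if "p \<in> P" for p
      using that ha(2) hb(2) h2(3) h3(3) idx_A2[of "a p"] idx_A3[of "b p"] by (simp add: A2_def A3_def)
    show "n < idx x + card T" if "x \<in> T" for x
      using bspec[OF idx(3) that] bij_betw_apply[OF eT that] n by simp
  qed
qed

end

section \<open>Pendant edge weights and target weights\<close>

text \<open>Here \<open>t\<close> is the number of late leaves and \<open>i\<close>,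
  \<open>j\<close> are numbers of such leaves. The hypotheses give \<open>3 * i >= n + 1\<close>, so
  two distinct late numbers add up to at least \<open>s + 2\<close> once
  \<open>n >= 4\<close>.\<close>

lemma late_leaf_bounds:
  fixes n s t i j :: nat
  assumes "2 \<le> n" "s = n div 2 + 1" "3 * t \<le> 2 * n + 2" "n < i + t"
  shows "min 2 (s - 1) \<le> min s i"
    and "n < j + t \<Longrightarrow> i \<noteq> j \<Longrightarrow> s + min 2 (s - 1) \<le> min s i + min s j"
proof -
  have i: "n + 1 \<le> 3 * i" using assms by linarith
  then show single: "min 2 (s - 1) \<le> min s i" using assms(1,2) by (auto simp: min_def)
  assume "n < j + t" "i \<noteq> j"
  then have j: "n + 1 \<le> 3 * j" using assms by linarith
  then have single': "min 2 (s - 1) \<le> min s j" using assms(1,2) by (auto simp: min_def)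
  show "s + min 2 (s - 1) \<le> min s i + min s j"
  proof (cases "s \<le> i \<or> s \<le> j")
    case True
    then show ?thesis using single single' by (auto simp: min_def)
  next
    case False
    have "2 * (n div 2) \<le> n" by simp
    moreover have "i < j \<or> j < i" using \<open>i \<noteq> j\<close> by auto
    ultimately have "s + 2 \<le> i + j" if "4 \<le> n" using i j assms(2) that by linarith
    \<comment> \<open>For smaller \<open>n\<close> one has \<open>s = 2\<close>, and of two distinct
      positive numbers one is at least 2, contrary to the case assumption.\<close>
    moreover have "4 \<le> n"
    proof (rule ccontr)
      assume "\<not> 4 \<le> n"
      then have "s = 2" using assms(1,2) by linarith
      then show False using False i j \<open>i \<noteq> j\<close> by linarith
    qed
    ultimately show ?thesis using False by (auto simp: min_def)
  qed
qed

lemma sum_le_mult_card: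
  fixes f :: "'a \<Rightarrow> nat"
  shows "(\<And>x. x \<in> X \<Longrightarrow> f x \<le> c) \<Longrightarrow> sum f X \<le> card X * c"
  using sum_bounded_above[of X f c] by simp

lemma mult_card_le_sum:
  fixes f :: "'a \<Rightarrow> nat"
  shows "(\<And>x. x \<in> X \<Longrightarrow> c \<le> f x) \<Longrightarrow> card X * c \<le> sum f X"
  using sum_bounded_below[of X c f] by simp

context pendant_structure
begin

text \<open>\<open>f x\<close> is the weight of the edge at the leaf \<open>x\<close>; its bounds
  say that the vertex weight \<open>idx x + 1 - f x\<close> lies in \<open>{1..s}\<close>.
  \<open>W v\<close> is the intended weighted degree of \<open>v\<close>, above all leaf values and
  within reach of a vertex weight in \<open>{1..s}\<close>. Both ends of a single-edge component
  must propose the same edge weight.\<close>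

lemma leaf_and_target_assignment:
  "\<exists>idx f W. bij_betw idx L {1..n} \<and>
     (\<forall>x\<in>L. 1 \<le> f x \<and> f x \<le> s \<and> f x \<le> idx x \<and> idx x + 1 \<le> f x + s) \<and>
     (\<forall>p\<in>P. f (a p) = f (b p)) \<and> inj_on W I \<and>
     (\<forall>v\<in>I. 2 * s < W v \<and> sum f (K v) + s * d v < W v \<and> W v \<le> sum f (K v) + s * d v + s)"
proof -
  obtain pr te T where pr: "\<And>v. v \<in> D \<Longrightarrow> pr v \<in> K v"
    and te: "\<And>v. v \<in> Y1 \<Longrightarrow> te v \<in> K v \<and> te v \<noteq> pr v"
    and TK: "\<And>v. v \<in> I \<Longrightarrow> T v \<subseteq> K v"
    and TU: "\<And>v. v \<in> U \<Longrightarrow> T v = K v"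
    and T2: "\<And>v. v \<in> J \<Longrightarrow> d v = 0 \<Longrightarrow> card (T v) = 2"
    and Tpr: "\<And>v. v \<in> J \<Longrightarrow> pr v \<notin> T v"
    and T0: "\<And>v. v \<in> J \<Longrightarrow> d v \<noteq> 0 \<Longrightarrow> T v = {}"
    by (fact special_leaves)
  have DI: "v \<in> I" "v \<in> J" if "v \<in> D" for v using that class_subsets by (auto simp: D_eq)
  have Y1D: "v \<in> D" if "v \<in> Y1" for v using that class_subsets by auto
  define TT where "TT = \<Union>(T ` I)"
  have inj_pr: "inj_on pr D"
    using pr DI K_unique by (metis inj_onI)
  have inj_te: "inj_on te Y1"
    using te DI Y1D K_unique by (metis inj_onI)
  have pr_eq: "v = w" if "v \<in> I" "w \<in> D" "pr w \<in> K v" for v w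
    using that pr[of w] DI[of w] K_unique by blast
  have te_eq: "v = w" if "v \<in> I" "w \<in> Y1" "te w \<in> K v" for v w
    using that te[of w] DI[of w] Y1D[of w] K_unique by blast
  have te_pr: "te v \<noteq> pr w" if "v \<in> Y1" "w \<in> D" for v w
    using pr_eq[of v w] te[of v] that DI Y1D by metis
  have disj1: "pr ` D \<inter> te ` Y1 = {}" using te_pr by (auto simp: image_iff) (metis)
  have disj2: "TT \<inter> pr ` D = {}"
  proof -
    have "pr w \<notin> T v" if "v \<in> I" "w \<in> D" for v w
      using pr_eq[of v w] TK[of v] Tpr[of w] DI[of w] that by blast
    then show ?thesis by (auto simp: TT_def)
  qed
  have disj3: "TT \<inter> te ` Y1 = {}"
  proof -
    have "te w \<notin> T v" if "v \<in> I" "w \<in> Y1" for v w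
    proof
      assume "te w \<in> T v"
      then have "v = w" using te_eq[of v w] TK[of v] that by blast
      then show False using \<open>te w \<in> T v\<close> T0[of w] DI[of w] Y1D[of w] that by (auto simp: Y1_def)
    qed
    then show ?thesis by (auto simp: TT_def)
  qed
  have prK: "pr ` D \<subseteq> \<Union>(K ` I)" using pr DI by blast
  have teK: "te ` Y1 \<subseteq> \<Union>(K ` I)" using te DI Y1D by blast
  have TTK: "TT \<subseteq> \<Union>(K ` I)" using TK by (auto simp: TT_def)
  obtain pos idx :: "'a \<Rightarrow> nat" where
    pos: "bij_betw pos J {1..card J}"
    and posD: "\<And>v. v \<in> D \<Longrightarrow> pos v \<le> card D"
    and posYZ: "\<And>v. v \<in> Y2 \<union> Z \<Longrightarrow> card G + card Y1 < pos v"
    and idx: "bij_betw idx L {1..n}"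
    and idx_pr: "\<And>v. v \<in> D \<Longrightarrow> idx (pr v) = pos v"
    and idx_npr: "\<And>x. x \<in> L \<Longrightarrow> x \<notin> pr ` D \<Longrightarrow> card D < idx x"
    and idx_te: "\<And>v. v \<in> Y1 \<Longrightarrow> idx (te v) = pos v + card Y1 + card Y2"
    and idx_b: "\<And>p. p \<in> P \<Longrightarrow> idx (b p) = idx (a p) + card P"
    and idx_T: "\<And>x. x \<in> TT \<Longrightarrow> n < idx x + card TT"
    by (fact numbering[OF inj_pr inj_te prK teK TTK disj1 disj2 disj3])
  \<comment> \<open>Vertexwise: on \<open>U\<close> all \<open>k v <= 2\<close> leaves are late, and
    \<open>3 * k v <= 2 * k v + 2\<close>; at a vertex of \<open>J\<close> with
    \<open>d v = 0\<close> two of at least three leaves are late.\<close>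
  have card_TT: "3 * card TT \<le> 2 * n + 2"
  proof -
    have "card TT \<le> (\<Sum>v\<in>I. card (T v))" unfolding TT_def by (rule card_UN_le[OF finI])
    then have "3 * card TT \<le> (\<Sum>v\<in>I. 3 * card (T v))" by (simp add: sum_distrib_left[symmetric])
    also have "\<dots> \<le> (\<Sum>v\<in>I. 2 * k v + (if v \<in> U then 2 else 0))"
    proof (rule sum_mono)
      fix v assume "v \<in> I"
      then consider "v \<in> U" "v \<notin> J" | "v \<notin> U" "v \<in> J" by (auto simp: J_def)
      then show "3 * card (T v) \<le> 2 * k v + (if v \<in> U then 2 else 0)"
      proof cases
        case 1
        then show ?thesis using deg_U[of v] TU[of v] by (simp add: k_def)
      next
        case 2
        then show ?thesis using deg_J[of v] T2[of v] T0[of v] by (cases "d v = 0") auto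
      qed
    qed
    also have "\<dots> = 2 * (\<Sum>v\<in>I. k v) + 2 * card {v\<in>I. v \<in> U}"
      using finI by (simp add: sum.distrib sum_indicator sum_distrib_left)
    also have "{v\<in>I. v \<in> U} = U" using UI by auto
    finally show ?thesis using cardU n_eq by linarith
  qed
  \<comment> \<open>The \<open>te\<close> leaves get the lightest admissible edge. All others get
    the heaviest, except that an end \<open>b p\<close> copies the value of \<open>a p\<close>,
    whose number is smaller by \<open>card P\<close>. Since \<open>card P < s\<close>, the vertex
    weight can absorb that difference.\<close>
  define f where "f x = (if x \<in> te ` Y1 then max 1 (idx x + 1 - s)
      else if x \<in> b ` P then min s (idx x - card P) else min s (idx x))" for x
  have K_not_b: "x \<notin> b ` P" "x \<notin> a ` P" "x \<in> L" if "v \<in> I" "x \<in> K v" for v x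
    using that K_ab_disj by (auto simp: L_eq)
  have idx_range: "1 \<le> idx x \<and> idx x \<le> n" if "x \<in> L" for x
    using bij_betw_apply[OF idx that] by simp
  have b_not_te: "b p \<notin> te ` Y1" "a p \<notin> te ` Y1" "a p \<notin> b ` P" "a p \<in> L" if "p \<in> P" for p
    using that teK K_ab_disj ab_disj by (auto simp: L_eq)
  have fb: "f (b p) = min s (idx (a p))" "f (a p) = min s (idx (a p))" if "p \<in> P" for p
    using that b_not_te idx_b by (auto simp: f_def)
  have cardP: "card P + 1 \<le> s" using n_eq by (simp add: s_def)
  have f_range: "1 \<le> f x \<and> f x \<le> s \<and> f x \<le> idx x \<and> idx x + 1 \<le> f x + s" if "x \<in> L" for x
  proof (cases "x \<in> b ` P")
    case True
    then obtain p where p: "p \<in> P" "x = b p" by auto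
    then show ?thesis using fb(1)[OF p(1)] idx_b[OF p(1)] idx_range[of "a p"] idx_range[OF that] b_not_te[OF p(1)]
        cardP s_ge_2 n_less by auto
  next
    case False
    then show ?thesis using idx_range[OF that] s_ge_2 n_less by (auto simp: f_def)
  qed
  have fK: "1 \<le> f x" "f x \<le> s" if "v \<in> I" "x \<in> K v" for v x
    using f_range[of x] K_not_b[OF that] by auto
  have f_TT: "f x = min s (idx x)" if "x \<in> TT" for x
  proof -
    have "x \<notin> te ` Y1" using that disj3 by (meson disjoint_iff)
    moreover have "x \<in> \<Union>(K ` I)" using subsetD[OF TTK that] .
    then obtain v where "v \<in> I" "x \<in> K v" by auto
    ultimately show ?thesis using K_not_b[of v x] by (simp add: f_def)
  qed
  have off: "offset \<le> 2" "offset \<le> s - 1" "1 \<le> offset" using s_ge_2 by (auto simp: offset_def)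
  have TT1: "offset \<le> f x" if "x \<in> TT" for x
    using late_leaf_bounds(1)[OF n_ge_2 s_def card_TT idx_T[OF that]] f_TT[OF that] by (simp add: offset_def)
  have TT2: "s + offset \<le> f x + f y" if "x \<in> TT" "y \<in> TT" "x \<noteq> y" for x y
  proof -
    have "x \<in> L" "y \<in> L" using that TTK by (auto simp: L_eq)
    then have "idx x \<noteq> idx y" using idx that(3) by (metis bij_betw_imp_inj_on inj_onD)
    then show ?thesis
      using late_leaf_bounds(2)[OF n_ge_2 s_def card_TT idx_T[OF that(1)] idx_T[OF that(2)]] f_TT that
      by (simp add: offset_def)
  qed
  have TT_pair: "s + offset \<le> sum f X" if X: "X \<subseteq> TT" "card X = 2" for X
  proof -
    obtain x y where "X = {x, y}" "x \<noteq> y" using X(2) by (auto simp: card_2_iff)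
    then show ?thesis using TT2[of x y] that by simp
  qed
  have cardJ: "card J + 2 \<le> n" using count_excess by (simp add: card_J)
  have pos_range: "1 \<le> pos v" "pos v \<le> card J" "pos v + 3 \<le> 2 * s" if "v \<in> J" for v
    using bij_betw_apply[OF pos that] cardJ n_less by auto
  have f_pr: "f (pr v) = min s (pos v)" if "v \<in> D" for v
  proof -
    have "pr v \<notin> te ` Y1" using that disj1 by blast
    then show ?thesis using that K_not_b[of v "pr v"] pr DI idx_pr by (simp add: f_def)
  qed
  define others where "others v = sum f (K v - {pr v})" for v
  have sum_K: "sum f (K v) = min s (pos v) + others v" if "v \<in> D" for v
    using that pr f_pr DI finite_K by (simp add: others_def sum.remove[of "K v" "pr v"])
  have card_others: "card (K v - {pr v}) = k v - 1" if "v \<in> D" for v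
    using that pr DI finite_K by (simp add: k_def card_Diff_singleton)
  \<comment> \<open>These leaves are numbered beyond \<open>card D >= pos v\<close>, and none of
    them is a \<open>te\<close> leaf or a \<open>b\<close> end, so each has the weight
    \<open>min s (idx x)\<close>.\<close>
  have others_low: "(k v - 1) * min s (pos v + 1) \<le> others v" if "v \<in> D" "v \<notin> Y1" for v
  proof -
    have "min s (pos v + 1) \<le> f x" if x: "x \<in> K v - {pr v}" for x
    proof -
      have "x \<notin> pr ` D" using x pr_eq[of v] \<open>v \<in> D\<close> DI by auto
      moreover have "x \<notin> te ` Y1" using x te_eq[of v] \<open>v \<notin> Y1\<close> \<open>v \<in> D\<close> DI by auto
      ultimately show ?thesis using idx_npr[of x] posD[OF \<open>v \<in> D\<close>] K_not_b[of v x] x DI[OF \<open>v \<in> D\<close>]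
        by (simp add: f_def)
    qed
    then have "card (K v - {pr v}) * min s (pos v + 1) \<le> sum f (K v - {pr v})"
      by (rule mult_card_le_sum)
    then show ?thesis using card_others that by (simp add: others_def)
  qed
  have others_high: "others v \<le> (k v - 1) * s" if "v \<in> D" for v
    using sum_le_mult_card[of "K v - {pr v}" f s] fK[of v] card_others[OF that] DI[OF that]
    by (simp add: others_def)
  have others_Y1: "f (te v) + 1 \<le> others v \<and> others v \<le> f (te v) + s" if "v \<in> Y1" for v
  proof -
    let ?R = "K v - {pr v} - {te v}"
    have v: "v \<in> D" "v \<in> I" using that Y1D DI by auto
    have tv: "te v \<in> K v - {pr v}" using te[OF that] by simp
    then have "card ?R = 1" using card_others[OF v(1)] that finite_K[OF v(2)] by (simp add: Y1_def)
    moreover have "others v = f (te v) + sum f ?R"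
      unfolding others_def using tv finite_K[OF v(2)] by (intro sum.remove) auto
    moreover have "1 \<le> f x \<and> f x \<le> s" if "x \<in> ?R" for x using fK[of v x] v that by auto
    ultimately show ?thesis using mult_card_le_sum[of ?R 1 f] sum_le_mult_card[of ?R f s] by simp
  qed
  have f_te: "f (te v) = max 1 (pos v + card Y1 + card Y2 + 1 - s)" if "v \<in> Y1" for v
    using that idx_te by (simp add: f_def)
  define S where "S v = sum f (K v) + s * d v" for v
  \<comment> \<open>The vertex of degree 2, if there is one, goes to position 0, below the positions
    of \<open>J\<close>, which start at 1.\<close>
  define pos0 where "pos0 v = (if v \<in> U then 0 else pos v)" for v
  \<comment> \<open>If \<open>pos v >= s\<close>, three contributions of \<open>s\<close> suffice
    because \<open>pos v + 3 <= 2 * s\<close>. Otherwise the \<open>pr\<close> leaf supplies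
    \<open>pos v\<close>, and the missing \<open>s + offset\<close> comes from two inner edges, from
    one inner edge and a further leaf, or from two late leaves.\<close>
  have reach_D: "s + offset + pos v \<le> S v" if v: "v \<in> D" "v \<notin> Y1" for v
  proof -
    have vJ: "v \<in> J" "v \<in> I" using v DI by auto
    note p = pos_range[OF vJ(1)]
    consider "2 \<le> d v" | "d v = 1" "2 \<le> k v" | "d v = 0" "3 \<le> k v"
      using deg_J[OF vJ(1)] by linarith
    then show ?thesis
    proof cases
      case 1
      then have "s * 2 \<le> s * d v" by (intro mult_le_mono) auto
      then show ?thesis using p off sum_K[OF v(1)] s_ge_2 unfolding S_def by linarith
    next
      case 2
      have "1 * min s (pos v + 1) \<le> (k v - 1) * min s (pos v + 1)"
        using 2 by (intro mult_le_mono) auto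
      from order_trans[OF this others_low[OF v]] have "min s (pos v + 1) \<le> others v" by simp
      then show ?thesis using 2 p off sum_K[OF v(1)] s_ge_2 by (simp add: S_def min_def split: if_splits)
    next
      case 3
      have "2 * min s (pos v + 1) \<le> (k v - 1) * min s (pos v + 1)"
        using 3 by (intro mult_le_mono) auto
      from order_trans[OF this others_low[OF v]] have 1: "2 * min s (pos v + 1) \<le> others v" .
      have "s + offset \<le> sum f (T v)" using T2[OF vJ(1) 3(1)] vJ by (intro TT_pair) (auto simp: TT_def)
      also have "\<dots> \<le> others v" unfolding others_def
        using TK[OF vJ(2)] Tpr[OF vJ(1)] finite_K[OF vJ(2)] by (intro sum_mono2) auto
      finally show ?thesis using 1 3 p off sum_K[OF v(1)] s_ge_2
        by (simp add: S_def min_def split: if_splits)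
    qed
  qed
  \<comment> \<open>If \<open>pos v > s\<close>, even the lightest edge at \<open>te v\<close>
    weighs at least \<open>pos v + 1 - s\<close>, which makes up for the cap in
    \<open>min s (pos v)\<close>.\<close>
  have reach_Y1: "s + offset + pos v \<le> S v" if "v \<in> Y1" for v
    using others_Y1[OF that] f_te[OF that] sum_K[OF Y1D[OF that]] off that
    by (auto simp: S_def Y1_def min_def max_def split: if_splits)
  have reach_Z: "s + offset + pos v \<le> S v" if "v \<in> Z" for v
  proof -
    have v: "v \<in> J" "k v = 0" using that by (auto simp: Z_def)
    then have "s * 3 \<le> s * d v" using deg_J[OF v(1)] by (intro mult_le_mono) auto
    then show ?thesis using pos_range[OF v(1)] off unfolding S_def by linarith
  qed
  have reach_U: "s + offset \<le> S v" if vU: "v \<in> U" for v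
  proof -
    have vI: "v \<in> I" using vU UI by auto
    have KT: "K v \<subseteq> TT" using TU[OF vU] vI by (auto simp: TT_def)
    consider "d v = 2" | "d v = 1" "k v = 1" | "d v = 0" "k v = 2" using deg_U[OF vU] by linarith
    then show ?thesis
    proof cases
      case 1
      then show ?thesis using off by (simp add: S_def)
    next
      case 2
      then obtain x where "K v = {x}" by (auto simp: k_def card_1_singleton_iff)
      then show ?thesis using TT1[of x] KT 2 by (simp add: S_def)
    next
      case 3
      then show ?thesis using TT_pair[OF KT] by (simp add: S_def k_def)
    qed
  qed
  have reach: "2 * s + offset + pos0 v \<le> S v + s" if v: "v \<in> I" for v
  proof -
    consider "v \<in> U" | "v \<in> D" "v \<notin> U" "v \<notin> Y1" | "v \<in> Y1" "v \<notin> U" | "v \<in> Z" "v \<notin> U"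
      using v J_eq by (auto simp: J_def)
    then show ?thesis
      by cases (use reach_D[of v] reach_Y1[of v] reach_Z[of v] reach_U[of v] in \<open>auto simp: pos0_def\<close>)
  qed
  \<comment> \<open>The edges at \<open>v\<close> weigh at most \<open>2 * s\<close> on
    \<open>U\<close>, \<open>2 * s + pos v\<close> on \<open>G\<close>, and
    \<open>2 * s + pos v + 1\<close> on \<open>Y1\<close> once the light edge has weight 1. By
    \<open>count_high\<close>, \<open>Y2\<close> and \<open>Z\<close> lie within the last
    \<open>s\<close> positions and are excluded.\<close>
  have low: "S v < 2 * s + offset + pos0 v" if vI: "v \<in> I" "pos0 v \<le> card J - s" for v
  proof -
    consider "v \<in> U" | "v \<notin> U" "v \<in> G" | "v \<notin> U" "v \<in> Y1" | "v \<notin> U" "v \<in> Y2 \<union> Z"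
      using vI J_eq by (auto simp: J_def D_def)
    then show ?thesis
    proof cases
      case 1
      have "sum f (K v) \<le> k v * s" unfolding k_def by (rule sum_le_mult_card) (use fK that in auto)
      then have "S v \<le> (k v + d v) * s" by (simp add: S_def algebra_simps)
      then show ?thesis using deg_U[OF 1] off by simp
    next
      case 2
      then have v: "v \<in> D" "v \<in> J" using class_subsets DI by auto
      have "S v \<le> pos v + (k v - 1) * s + s * d v"
        using sum_K[OF v(1)] others_high[OF v(1)] by (simp add: S_def)
      also have "\<dots> = pos v + (k v - 1 + d v) * s" by (simp add: algebra_simps)
      also have "k v - 1 + d v = 2" using 2 by (auto simp: G_def)
      finally show ?thesis using off 2 by (simp add: pos0_def)
    next
      case 3
      then have v: "v \<in> D" "v \<in> J" using Y1D DI by auto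
      have p: "1 \<le> pos v" "pos v \<le> card J - s" using pos_range[OF v(2)] that 3 by (auto simp: pos0_def)
      \<comment> \<open>The left side is at most
        \<open>card J + card Y1 + card Y2 - s <= n - 2 - s\<close>. Moreover
        \<open>1 <= card J - s\<close> forces \<open>s >= 4\<close>, hence \<open>offset = 2\<close>
        below.\<close>
      then have "pos v + card Y1 + card Y2 \<le> s" using count_excess n_less card_J by linarith
      then have "f (te v) = 1" using f_te[OF 3(2)] by simp
      moreover have "offset = 2" using p cardJ n_less by (auto simp: offset_def)
      moreover have "d v = 1" using 3 by (simp add: Y1_def)
      ultimately show ?thesis using others_Y1[OF 3(2)] sum_K[OF v(1)] 3 by (auto simp: S_def pos0_def min_def)
    next
      case 4
      then show ?thesis using posYZ[of v] that count_high card_J by (auto simp: pos0_def)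
    qed
  qed
  have inj: "inj_on pos0 I"
  proof (rule inj_onI)
    fix v w assume vw: "v \<in> I" "w \<in> I" "pos0 v = pos0 w"
    have U1: "x = y" if "x \<in> U" "y \<in> U" for x y
      using that cardU by (metis card_le_Suc0_iff_eq One_nat_def finite_classes(2))
    have "1 \<le> pos x" if "x \<in> I" "x \<notin> U" for x using pos_range[of x] that by (simp add: J_def)
    then show "v = w" using vw U1[of v w] inj_onD[OF bij_betw_imp_inj_on[OF pos], of v w]
      by (force simp: pos0_def J_def split: if_splits)
  qed
  have pos0_le: "pos0 v \<le> card J" if "v \<in> I" for v using pos_range[of v] that by (simp add: pos0_def J_def)
  have "\<exists>W. inj_on W I \<and> (\<forall>v\<in>I. 2 * s + offset \<le> W v \<and> S v < W v \<and> W v \<le> S v + s)"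
    using distinct_targets[of I pos0 "card J" "2 * s + offset" S s] finI inj pos0_le reach low by blast
  then obtain W where W: "inj_on W I" "\<forall>v\<in>I. 2 * s + offset \<le> W v \<and> S v < W v \<and> W v \<le> S v + s"
    by (elim exE conjE) (rule that)
  show ?thesis
  proof (intro exI conjI)
    show "bij_betw idx L {1..n}" by (rule idx)
    show "\<forall>x\<in>L. 1 \<le> f x \<and> f x \<le> s \<and> f x \<le> idx x \<and> idx x + 1 \<le> f x + s"
      using f_range by (intro ballI)
    show "\<forall>p\<in>P. f (a p) = f (b p)" using fb by simp
    show "inj_on W I" by (rule W)
    show "\<forall>v\<in>I. 2 * s < W v \<and> sum f (K v) + s * d v < W v \<and> W v \<le> sum f (K v) + s * d v + s"
      using W(2) off by (fastforce simp: S_def)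
  qed
qed

end

section \<open>Irregular weightings of forests\<close>

lemma degree_1_edge: "degree E x = 1 \<Longrightarrow> \<exists>e. {e\<in>E. x \<in> e} = {e}"
  unfolding degree_def by (erule card_1_singletonE) (rule exI)

lemma irregular_lower_bound:
  assumes "irregular_total_weighting V E s wv we" and "0 < card {v\<in>V. degree E v = 1}"
  shows "card {v\<in>V. degree E v = 1} + 1 \<le> 2 * s"
proof -
  let ?L = "{v\<in>V. degree E v = 1}"
  have "wt E wv we x \<in> {2..2 * s}" if "x \<in> ?L" for x
  proof -
    have "\<exists>e. {e\<in>E. x \<in> e} = {e}" using that degree_1_edge[of E x] by blast
    then obtain e where e: "{e\<in>E. x \<in> e} = {e}" ..
    then have "e \<in> E" by auto
    then have "1 \<le> we e \<and> we e \<le> s" "1 \<le> wv x \<and> wv x \<le> s"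
      using assms(1) that by (auto simp: irregular_total_weighting_def)
    then show ?thesis by (simp add: wt_def e)
  qed
  then have "card (wt E wv we ` ?L) \<le> card {2..2 * s}" by (intro card_mono) auto
  moreover have "inj_on (wt E wv we) ?L"
    using assms(1) by (auto simp: irregular_total_weighting_def intro: inj_on_subset)
  \<comment> \<open>The interval has \<open>2 * s - 1\<close> elements; the existence of a leaf
    rules out \<open>s = 0\<close>, where this subtraction would be truncated.\<close>
  ultimately show ?thesis using assms(2) by (simp add: card_image)
qed

text \<open>The forest is turned into an instance of \<open>pendant_structure\<close>, and each
  vertex weight becomes the intended weighted degree minus the incident edge weights. The bound
  \<open>2 <= ...\<close> supplies the leaves that \<open>irregular_lower_bound\<close> asks
  for.\<close>

lemma irregular_weighting_exists:
  assumes F: "forest V E" and "V \<noteq> {}"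
    and pos_deg: "\<forall>v\<in>V. degree E v \<noteq> 0"
    and one_deg2: "card {v\<in>V. degree E v = 2} \<le> 1"
  shows "2 \<le> card {v\<in>V. degree E v = 1} \<and>
    (\<exists>wv we. irregular_total_weighting V E (card {v\<in>V. degree E v = 1} div 2 + 1) wv we)"
proof -
  have sg: "simple_graph V E" using F by (simp add: forest_def)
  have finV: "finite V" using sg by (simp add: simple_graph_def)
  define L where "L = {v\<in>V. degree E v = 1}"
  define U where "U = {v\<in>V. degree E v = 2}"
  define I where "I = {v\<in>V. 2 \<le> degree E v}"
  define K where "K v = neighbours E v \<inter> L" for v
  define d where "d v = card (neighbours E v \<inter> I)" for v
  \<comment> \<open>The single-edge components are indexed by their own edges; \<open>a\<close> and
    \<open>b\<close> will pick the two ends.\<close>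
  define P where "P = {e\<in>E. e \<subseteq> L}"
  have V: "V = L \<union> I" using pos_deg by (force simp: L_def I_def)
  have LI: "x \<notin> I" if "x \<in> L" for x using that by (simp add: L_def I_def)
  have fin: "finite L" "finite I" "finite (neighbours E v)" for v
    using finV finite_neighbours[OF sg] by (auto simp: L_def I_def)
  have nb: "neighbours E v = K v \<union> (neighbours E v \<inter> I)" for v
    using neighbours_subset[OF sg, of v] V by (auto simp: K_def)
  have deg: "degree E v = card (K v) + d v" for v
  proof -
    have "card (K v \<union> (neighbours E v \<inter> I)) = card (K v) + card (neighbours E v \<inter> I)"
      using fin LI by (intro card_Un_disjoint) (auto simp: K_def)
    then show ?thesis using nb[of v] degree_eq_card_neighbours[OF sg, of v] by (simp add: d_def)
  qed
  have leaf_edge: "e = e'" if "x \<in> L" "e \<in> E" "e' \<in> E" "x \<in> e" "x \<in> e'" for x e e'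
  proof -
    have "\<exists>e. {e\<in>E. x \<in> e} = {e}" using that(1) degree_1_edge[of E x] unfolding L_def by blast
    then obtain e0 where e0: "{e\<in>E. x \<in> e} = {e0}" ..
    have "e \<in> {e\<in>E. x \<in> e}" "e' \<in> {e\<in>E. x \<in> e}" using that by auto
    then show ?thesis unfolding e0 by simp
  qed
  have finP: "finite P"
    by (rule finite_subset[of _ "Pow L"]) (auto simp: P_def fin)
  have "\<exists>x y. e = {x, y} \<and> x \<noteq> y" if "e \<in> P" for e
    using that sg by (auto simp: P_def simple_graph_def card_2_iff)
  then obtain a b where ab: "\<And>e. e \<in> P \<Longrightarrow> e = {a e, b e} \<and> a e \<noteq> b e" by metis
  have abL: "a e \<in> e" "b e \<in> e" "a e \<in> L" "b e \<in> L" "e \<in> E" if "e \<in> P" for e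
    using ab[OF that] that by (auto simp: P_def)
  have P_unique: "e = e'" if "e \<in> P" "e' \<in> E" "x \<in> e" "x \<in> e'" for e e' x
    using leaf_edge[of x e e'] that by (auto simp: P_def)
  have K_edge: "{v, x} \<in> E" "x \<in> L" if "x \<in> K v" for v x
    using that by (auto simp: K_def neighbours_def)
  have K_disj: "K v \<inter> K w = {}" if "v \<noteq> w" for v w
  proof -
    have False if "x \<in> K v" "x \<in> K w" for x
    proof -
      have "{v, x} = {w, x}"
        using leaf_edge[of x "{v, x}" "{w, x}"] K_edge that by auto
      then show False using \<open>v \<noteq> w\<close> by (auto simp: doubleton_eq_iff)
    qed
    then show ?thesis by auto
  qed
  have K_P: False if "v \<in> I" "x \<in> K v" "e \<in> P" "x \<in> e" for v x e
  proof -
    have "e = {v, x}" using P_unique[of e "{v, x}" x] K_edge that by auto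
    then show False using that LI by (auto simp: P_def)
  qed
  have L_eq: "L = \<Union>(K ` I) \<union> a ` P \<union> b ` P"
  proof
    show "L \<subseteq> \<Union>(K ` I) \<union> a ` P \<union> b ` P"
    proof
      fix x assume x: "x \<in> L"
      then have "card (neighbours E x) = 1"
        using degree_eq_card_neighbours[OF sg] by (simp add: L_def)
      then obtain y where "neighbours E x = {y}" by (auto simp: card_1_singleton_iff)
      then have y: "y \<in> neighbours E x" "x \<in> neighbours E y" using neighbours_sym by fast+
      then have "y \<in> V" using neighbours_subset[OF sg] by auto
      then consider "y \<in> I" | "y \<in> L" using V by auto
      then show "x \<in> \<Union>(K ` I) \<union> a ` P \<union> b ` P"
      proof cases
        case 1
        then show ?thesis using x y by (auto simp: K_def)
      next
        case 2
        then have "{x, y} \<in> P" using x y by (auto simp: P_def neighbours_def)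
        then show ?thesis using ab[of "{x, y}"] by auto
      qed
    qed
    show "\<Union>(K ` I) \<union> a ` P \<union> b ` P \<subseteq> L" using abL by (auto simp: K_def)
  qed
  have sumV: "(\<Sum>v\<in>V. degree E v) + 2 \<le> 2 * card V"
  proof -
    have "card (neighbours E v \<inter> V) = degree E v" for v
      using neighbours_subset[OF sg, of v] degree_eq_card_neighbours[OF sg, of v] by (simp add: Int_absorb2)
    then show ?thesis using forest_induced_degree_sum[OF F subset_refl \<open>V \<noteq> {}\<close>] by simp
  qed
  have UI: "U \<subseteq> I" by (auto simp: U_def I_def)
  have degJ: "3 \<le> card (K v) + d v" if "v \<in> I - U" for v
    using that deg[of v] by (auto simp: I_def U_def)
  \<comment> \<open>Subtract 2 per vertex in \<open>sumV\<close>: a leaf then counts -1, a vertex of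
    \<open>U\<close> counts 0, and a vertex of \<open>J\<close> counts its degree minus 2.\<close>
  have excess: "(\<Sum>v\<in>I - U. card (K v) + d v - 2) + 2 \<le> card L"
  proof -
    have finU: "finite U" using UI fin finite_subset by auto
    have sum3: "sum g V = sum g L + (sum g U + sum g (I - U))" for g :: "'a \<Rightarrow> nat"
    proof -
      have "sum g V = sum g L + sum g I" unfolding V using fin LI by (intro sum.union_disjoint) auto
      then show ?thesis using sum.subset_diff[OF UI fin(2), of g] by simp
    qed
    have "(\<Sum>v\<in>I - U. degree E v) = (\<Sum>v\<in>I - U. (card (K v) + d v - 2) + 2)"
      using degJ deg by (intro sum.cong) fastforce+
    also have "\<dots> = (\<Sum>v\<in>I - U. card (K v) + d v - 2) + 2 * card (I - U)"
      by (simp only: sum.distrib) simp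
    finally have "(\<Sum>v\<in>V. degree E v) = card L + (2 * card U + ((\<Sum>v\<in>I - U. card (K v) + d v - 2) + 2 * card (I - U)))"
      by (subst sum3) (simp add: L_def U_def)
    moreover have "card V = card L + (card U + card (I - U))"
      using sum3[of "\<lambda>_. 1"] by simp
    ultimately show ?thesis using sumV by linarith
  qed
  have branching: "card {v\<in>I. 3 \<le> d v} \<le> card {v\<in>I. d v = 1}"
  proof -
    \<comment> \<open>Dropping the inner vertices without inner neighbours does not change
      \<open>d\<close> on the rest. There \<open>2 + [3 <= d v] <= d v + [d v = 1]\<close>, and the
      forest bound gives an average of \<open>d\<close> of at most 2.\<close>
    define W where "W = {v\<in>I. 1 \<le> d v}"
    have finW: "finite W" using fin by (simp add: W_def)
    have sumW: "(\<Sum>v\<in>W. d v) \<le> 2 * card W"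
    proof (cases "W = {}")
      case False
      have "neighbours E v \<inter> W = neighbours E v \<inter> I" if "v \<in> W" for v
      proof -
        have "w \<in> W" if "w \<in> neighbours E v" "w \<in> I" for w
        proof -
          have "v \<in> neighbours E w \<inter> I" using that \<open>v \<in> W\<close> neighbours_sym[of w E v] by (auto simp: W_def)
          then have "0 < d w" unfolding d_def using fin by (metis card_gt_0_iff empty_iff finite_Int)
          then show ?thesis using that by (simp add: W_def)
        qed
        then show ?thesis by (auto simp: W_def)
      qed
      moreover have "W \<subseteq> V" by (auto simp: W_def I_def)
      ultimately show ?thesis using forest_induced_degree_sum[OF F _ False] by (simp add: d_def)
    qed simp
    have "(\<Sum>v\<in>W. 2 + (if 3 \<le> d v then 1 else 0)) \<le> (\<Sum>v\<in>W. d v + (if d v = 1 then 1 else 0))"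
      by (rule sum_mono) (auto simp: W_def)
    then have "2 * card W + card {v\<in>W. 3 \<le> d v} \<le> (\<Sum>v\<in>W. d v) + card {v\<in>W. d v = 1}"
      unfolding sum.distrib using finW by (simp add: sum.If_cases Int_def)
    moreover have "{v\<in>W. 3 \<le> d v} = {v\<in>I. 3 \<le> d v}" "{v\<in>W. d v = 1} = {v\<in>I. d v = 1}"
      by (auto simp: W_def)
    ultimately show ?thesis using sumW by simp
  qed
  interpret pendant_structure I U L K d P a b
  proof
    show "inj_on a P" "inj_on b P" using abL P_unique by (metis inj_onI)+
    show "a ` P \<inter> b ` P = {}"
    proof -
      have "a e \<noteq> b e'" if "e \<in> P" "e' \<in> P" for e e'
        using P_unique[of e e' "a e"] abL[of e] abL[of e'] ab[of e] that by metis
      then show ?thesis by (auto simp: image_iff)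
    qed
    show "\<Union>(K ` I) \<inter> (a ` P \<union> b ` P) = {}" using K_P abL by blast
    show "card (K v) + d v = 2" if "v \<in> U" for v using that deg[of v] by (simp add: U_def)
  qed (use fin finP UI degJ K_disj L_eq excess branching one_deg2 in \<open>auto simp: U_def\<close>)
  have s_eq: "s = card {v\<in>V. degree E v = 1} div 2 + 1" unfolding s_def n_def by (simp only: L_def)
  obtain idx f W where idx: "bij_betw idx L {1..n}"
    and f: "\<forall>x\<in>L. 1 \<le> f x \<and> f x \<le> s \<and> f x \<le> idx x \<and> idx x + 1 \<le> f x + s"
    and fP: "\<forall>p\<in>P. f (a p) = f (b p)" and W: "inj_on W I"
    and WS: "\<forall>v\<in>I. 2 * s < W v \<and> sum f (K v) + s * d v < W v \<and> W v \<le> sum f (K v) + s * d v + s"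
    using leaf_and_target_assignment by (elim exE conjE) (rule that)
  \<comment> \<open>The chosen leaf does not matter: an edge with two leaves belongs to
    \<open>P\<close>, where \<open>fP\<close> makes \<open>f\<close> agree on both ends.\<close>
  define we where "we e = (if e \<subseteq> I then s else f (SOME x. x \<in> e \<inter> L))" for e
  define wv where "wv v = (if v \<in> L then idx v + 1 - f v else W v - (sum f (K v) + s * d v))" for v
  have we_leaf: "we e = f x" if ex: "e \<in> E" "x \<in> e" "x \<in> L" for e x
  proof -
    define z where "z = (SOME x. x \<in> e \<inter> L)"
    have z: "z \<in> e \<inter> L" unfolding z_def by (rule someI[of _ x]) (use that in simp)
    have "f z = f x"
    proof (cases "z = x")
      case False
      obtain y where "e = {x, y}" by (rule edge_endpoints[OF sg ex(1,2)])
      then have "e \<in> P" using False z that by (auto simp: P_def)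
      then show ?thesis using ab[of e] fP z that(2) by (metis IntD1 empty_iff insert_iff)
    qed simp
    then show ?thesis using that LI by (auto simp: we_def z_def)
  qed
  have wt_leaf: "wt E wv we x = idx x + 1" if "x \<in> L" for x
  proof -
    have "(\<Sum>e\<in>{e\<in>E. x \<in> e}. we e) = (\<Sum>e\<in>{e\<in>E. x \<in> e}. f x)"
      using we_leaf that by (intro sum.cong) auto
    also have "\<dots> = f x" using that by (simp add: L_def degree_def)
    finally show ?thesis using that bspec[OF f that] by (simp add: wt_def wv_def)
  qed
  have wt_inner: "wt E wv we v = W v" if "v \<in> I" for v
  proof -
    have "(\<Sum>e\<in>{e\<in>E. v \<in> e}. we e) = (\<Sum>w\<in>neighbours E v. we {v, w})"
      by (rule sum_incident_edges[OF sg])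
    also have "\<dots> = (\<Sum>w\<in>K v. we {v, w}) + (\<Sum>w\<in>neighbours E v \<inter> I. we {v, w})"
      by (subst nb, rule sum.union_disjoint) (use fin LI in \<open>auto simp: K_def\<close>)
    also have "(\<Sum>w\<in>K v. we {v, w}) = sum f (K v)"
      using we_leaf K_edge by (intro sum.cong) auto
    also have "(\<Sum>w\<in>neighbours E v \<inter> I. we {v, w}) = (\<Sum>w\<in>neighbours E v \<inter> I. s)"
      using that by (intro sum.cong) (auto simp: we_def)
    finally have "(\<Sum>e\<in>{e\<in>E. v \<in> e}. we e) = sum f (K v) + s * d v" by (simp add: d_def)
    moreover have "v \<notin> L" using that LI by auto
    ultimately show ?thesis using WS that by (fastforce simp: wt_def wv_def)
  qed
  have "irregular_total_weighting V E s wv we"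
    unfolding irregular_total_weighting_def
  proof (intro conjI ballI)
    show "wv v \<in> {1..s}" if "v \<in> V" for v
    proof (cases "v \<in> L")
      case True
      then have "f v \<le> idx v" "idx v + 1 \<le> f v + s" using f by auto
      then show ?thesis using True by (auto simp: wv_def)
    next
      case False
      then have "v \<in> I" using that V by auto
      then have "sum f (K v) + s * d v < W v" "W v \<le> sum f (K v) + s * d v + s" using WS by auto
      then show ?thesis using False by (auto simp: wv_def)
    qed
    show "we e \<in> {1..s}" if "e \<in> E" for e
    proof (cases "e \<subseteq> I")
      case True
      then show ?thesis using s_ge_2 by (simp add: we_def)
    next
      case False
      moreover have "e \<subseteq> V" using sg that by (simp add: simple_graph_def)
      ultimately obtain x where "x \<in> e" "x \<in> L" using V by auto
      then show ?thesis using we_leaf[OF that] f by auto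
    qed
    have "wt E wv we x \<le> 2 * s" if "x \<in> L" for x
      using wt_leaf[OF that] bij_betw_apply[OF idx that] n_less by simp
    moreover have "2 * s < wt E wv we v" if "v \<in> I" for v
      using wt_inner[OF that] WS that by simp
    ultimately have "wt E wv we x \<noteq> wt E wv we v" if "x \<in> L" "v \<in> I" for x v
      using that by (metis leD)
    moreover have "inj_on (wt E wv we) L"
      using bij_betw_imp_inj_on[OF idx] wt_leaf by (simp add: inj_on_def)
    moreover have "inj_on (wt E wv we) I"
      using W wt_inner by (simp add: inj_on_def)
    ultimately show "inj_on (wt E wv we) V"
      unfolding V inj_on_Un by blast
  qed
  moreover have "2 \<le> card {v\<in>V. degree E v = 1}" using n_ge_2 unfolding n_def by (simp only: L_def)
  ultimately show ?thesis unfolding s_eq by blast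
qed

section \<open>The value of \<open>tvs\<close>\<close>

lemma nat_ceiling_half: "nat \<lceil>(real n + 1) / 2\<rceil> = n div 2 + 1"
proof -
  have "\<lceil>(real n + 1) / 2\<rceil> = int (n div 2 + 1)"
    by (rule ceiling_unique) (cases "even n"; auto elim!: evenE oddE)+
  then show ?thesis by simp
qed

theorem theorem2:
  fixes V :: "'a set" and E :: "'a set set"
  assumes "forest V E" and "V \<noteq> {}"
    and "\<forall>v\<in>V. degree E v \<noteq> 0"
    and "card {v\<in>V. degree E v = 2} \<le> 1"
  shows "tvs V E = nat \<lceil>(real (card {v\<in>V. degree E v = 1}) + 1) / 2\<rceil>"
proof -
  let ?n = "card {v\<in>V. degree E v = 1}"
  have ex: "2 \<le> ?n" "\<exists>wv we. irregular_total_weighting V E (?n div 2 + 1) wv we"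
    using irregular_weighting_exists[OF assms] by auto
  have "tvs V E = ?n div 2 + 1"
    unfolding tvs_def
  proof (rule Least_equality)
    fix s assume "\<exists>wv we. irregular_total_weighting V E s wv we"
    then have "?n + 1 \<le> 2 * s"
      using irregular_lower_bound[of V E s] ex(1) by auto
    then show "?n div 2 + 1 \<le> s" by linarith
  qed (rule ex(2))
  then show ?thesis by (simp only: nat_ceiling_half)
qed

end
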